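(* Let $t\ge1$, fix distinct positive integers $\ell_1,\dots,\ell_t$, and let $H'=\{A\subseteq[n]: |A|\text{ is odd}\}$. There exists a threshold $n_0=n_0(\ell_1,\dots,\ell_t)$ such that, for all $n\ge n_0$, any family $\mathcal F\subseteq H'$ satisfying $|A\triangle B|\in\{2\ell_1,\dots,2\ell_t\}$ for all distinct $A,B\in\mathcal F$ obeys the bound $$|\mathcal F|\le \sum_{i=0}^{t}\binom{n-1}{i}.$$ Moreover, this bound is sharp for the distance set $\{2,4,\dots,2t\}$: for $\ell_j=j$ ($1\le j\le t$) and all $n\ge n_0(1,\dots,t)$ there is such a family $\mathcal F\subseteq H'$ with $|\mathcal F|=\sum_{i=0}^{t}\binom{n-1}{i}$.
   Context: Here $[n]=\{1,\dots,n\}$ and $\triangle$ denotes symmetric difference of sets. The set $H'$ is called the odd subcube. *)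

theory Defs
  imports Complex_Main
begin

definition odd_subcube :: "nat \<Rightarrow> nat set set" where
  "odd_subcube n = {A. A \<subseteq> {1..n} \<and> odd (card A)}"

definition distances_in :: "nat set \<Rightarrow> nat set set \<Rightarrow> bool" where
  "distances_in D F \<longleftrightarrow> (\<forall>A\<in>F. \<forall>B\<in>F. A \<noteq> B \<longrightarrow> card (sym_diff A B) \<in> D)"

end

(* With z i = \<plusminus>1 recording whether A and B agree at i, the sum of the z i is n - 2 |A \<triangle> B|,
   so the product over j of (\<Sum>i. z i) - (n - 4 l j) vanishes at every allowed distance and is
   positive on the diagonal.  If n \<ge> 4 l j for all j, its multilinear expansion has coefficient of
   sign (-1)^(t - |S|) at the character S, so as a quadratic form on functions on F it is positive
   definite and yet has at most as many positive squares as there are S with |S| \<le> t and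
   |S| \<equiv> t (mod 2).  Forgetting the element n turns these S into all subsets of {1..n-1} of size
   at most t; the same bijection yields the extremal family. *)
theory Submission
  imports Defs
begin

section \<open>Linear algebra: homogeneous systems with more unknowns than equations\<close>

text \<open>Gaussian elimination, with \<open>T\<close> indexing the equations and \<open>F\<close>
  the unknowns. A nonzero entry \<open>a s A0\<close> serves as pivot: eliminating the unknown
  \<open>A0\<close> removes one equation and one unknown, so the strict inequality of cardinalities
  survives.\<close>

lemma nontrivial_solution:
  fixes a :: "'b \<Rightarrow> 'a \<Rightarrow> real"
  assumes "finite T" "finite F" "card T < card F"
  shows "\<exists>g. (\<exists>A\<in>F. g A \<noteq> 0) \<and> (\<forall>s\<in>T. (\<Sum>A\<in>F. g A * a s A) = 0)"
  using assms
proof (induction T arbitrary: F a rule: finite_induct)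
  case empty
  then show ?case
    by (intro exI[of _ "\<lambda>_. 1"]) (auto simp: card_gt_0_iff)
next
  case (insert s T)
  show ?case
  proof (cases "\<forall>A\<in>F. a s A = 0")
    case True
    have "card T < card F" using insert by simp
    then obtain g where "\<exists>A\<in>F. g A \<noteq> 0" "\<forall>r\<in>T. (\<Sum>A\<in>F. g A * a r A) = 0"
      using insert.IH[of F a] insert.prems by blast
    with True show ?thesis by (intro exI[of _ g]) auto
  next
    case False
    then obtain A0 where A0: "A0 \<in> F" "a s A0 \<noteq> 0" by blast
    define F' where "F' = F - {A0}"
    have F': "finite F'" "A0 \<notin> F'" "F = insert A0 F'" "card T < card F'"
      using insert A0 by (auto simp: F'_def)
    obtain g where g: "\<exists>A\<in>F'. g A \<noteq> 0"
      "\<And>r. r \<in> T \<Longrightarrow> (\<Sum>A\<in>F'. g A * (a r A - a r A0 * a s A / a s A0)) = 0"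
      using insert.IH[of F' "\<lambda>r A. a r A - a r A0 * a s A / a s A0"] F' by blast
    \<comment> \<open>This is the value that equation \<open>s\<close> forces on the unknown
      \<open>A0\<close>. The coefficients of the reduced system are what remains of the other
      equations after substituting it.\<close>
    define c where "c = - (\<Sum>A\<in>F'. g A * a s A) / a s A0"
    have split: "(\<Sum>A\<in>F. (g(A0 := c)) A * a r A) = c * a r A0 + (\<Sum>A\<in>F'. g A * a r A)" for r
    proof -
      have "(\<Sum>A\<in>F'. (g(A0 := c)) A * a r A) = (\<Sum>A\<in>F'. g A * a r A)"
        by (rule sum.cong) (use F' in auto)
      then show ?thesis using F' by simp
    qed
    have "(\<Sum>A\<in>F. (g(A0 := c)) A * a r A) = 0" if "r \<in> insert s T" for r
    proof (cases "r = s")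
      case True
      then show ?thesis using A0 by (simp only: split) (simp add: c_def)
    next
      case False
      then have "(\<Sum>A\<in>F'. g A * (a r A - a r A0 * a s A / a s A0)) = 0" using g that by blast
      also have "(\<Sum>A\<in>F'. g A * (a r A - a r A0 * a s A / a s A0))
        = (\<Sum>A\<in>F'. g A * a r A) - (\<Sum>A\<in>F'. g A * a s A) * (a r A0 / a s A0)"
        by (simp add: right_diff_distrib sum_subtractf sum_distrib_left sum_divide_distrib mult_ac)
      finally show ?thesis by (simp only: split) (simp add: c_def)
    qed
    moreover have "\<exists>A\<in>F. (g(A0 := c)) A \<noteq> 0" using g(1) F' by auto
    ultimately show ?thesis by blast
  qed
qed

section \<open>Characters of the cube\<close>

text \<open>These are the Walsh characters of the group of finite sets under symmetric difference.
  The formula is symmetric in \<open>S\<close> and \<open>A\<close>, so multiplicativity in one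
  argument gives it in the other.\<close>

definition character :: "'a set \<Rightarrow> 'a set \<Rightarrow> real" where
  "character S A = (-1) ^ card (S \<inter> A)"

lemma minus_one_power_card_sym_diff:
  assumes "finite A" "finite B"
  shows "(-1 :: real) ^ card (sym_diff A B) = (-1) ^ card A * (-1) ^ card B"
proof -
  have "card A = card (A - B) + card (A \<inter> B)" "card B = card (B - A) + card (A \<inter> B)"
    using assms card_Int_Diff[of A B] card_Int_Diff[of B A] by (simp_all add: Int_commute)
  moreover have "card (sym_diff A B) = card (A - B) + card (B - A)"
    using assms by (intro card_Un_disjoint) auto
  ultimately show ?thesis
    by (simp add: power_add flip: power_mult_distrib)
qed

lemma character_sym_diff_left:
  assumes "finite S" "finite T"
  shows "character (sym_diff S T) A = character S A * character T A"
proof -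
  have "sym_diff S T \<inter> A = sym_diff (S \<inter> A) (T \<inter> A)" by blast
  then show ?thesis
    using minus_one_power_card_sym_diff[of "S \<inter> A" "T \<inter> A"] assms by (simp add: character_def)
qed

lemma character_sym_diff_right:
  assumes "finite A" "finite B"
  shows "character S (sym_diff A B) = character S A * character S B"
  using character_sym_diff_left[OF assms, of S] by (simp add: character_def Int_commute)

text \<open>An index in \<open>D\<close> contributes -1 and any other index of \<open>X\<close>
  contributes 1. This makes a polynomial in \<open>card D\<close> a polynomial in
  characters.\<close>

lemma sum_character_singleton:
  assumes "finite X" "D \<subseteq> X"
  shows "(\<Sum>i\<in>X. character {i} D) = real (card X) - 2 * real (card D)"
proof -
  have "(\<Sum>i\<in>X. character {i} D) = (\<Sum>i\<in>X. 1 - 2 * (if i \<in> D then 1 else 0))"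
    by (rule sum.cong) (auto simp: character_def)
  also have "\<dots> = real (card X) - 2 * real (card (X \<inter> D))"
    using assms by (simp add: sum_subtractf sum.If_cases flip: sum_distrib_left)
  finally show ?thesis using assms by (simp add: Int_absorb1)
qed

section \<open>Signs of the coefficients in the character expansion\<close>

text \<open>Induction on the factors. Multiplying by \<open>character {i}\<close> toggles
  \<open>i\<close> in \<open>S\<close>, which flips the parity of \<open>card S\<close>; multiplying
  by \<open>- m j\<close> keeps \<open>S\<close> but flips the sign. Both effects match the new
  factor -1 in \<open>(-1) ^ card J\<close>, so the weights \<open>b\<close> only ever receive
  nonnegative terms, and degrees grow by at most one per factor.\<close>

lemma sign_alternating_expansion:
  fixes m :: "'b \<Rightarrow> real"
  assumes "finite X" "finite J" "\<And>j. j \<in> J \<Longrightarrow> m j \<ge> 0"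
  shows "\<exists>b. (\<forall>S. b S \<ge> 0) \<and> (\<forall>S. finite S \<longrightarrow> b S \<noteq> 0 \<longrightarrow> card S \<le> card J) \<and>
    (\<forall>D. (\<Prod>j\<in>J. (\<Sum>i\<in>X. character {i} D) - m j)
       = (-1) ^ card J * (\<Sum>S\<in>Pow X. (-1) ^ card S * b S * character S D))"
  using assms(2,3)
proof (induction J rule: finite_induct)
  case empty
  have "(\<Sum>S\<in>Pow X. (-1) ^ card S * (if S = {} then 1 else 0) * character S D) = 1" for D
  proof -
    have "(\<Sum>S\<in>Pow X. (-1) ^ card S * (if S = {} then 1 else 0) * character S D)
      = (\<Sum>S\<in>Pow X. if S = {} then 1 else 0)"
      by (rule sum.cong) (auto simp: character_def)
    then show ?thesis using assms(1) by simp
  qed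
  then show ?case
    by (intro exI[of _ "\<lambda>S. if S = {} then 1 else 0"]) auto
next
  case (insert j J)
  obtain b where b: "\<And>S. b S \<ge> 0" "\<And>S. finite S \<Longrightarrow> b S \<noteq> 0 \<Longrightarrow> card S \<le> card J"
    "\<And>D. (\<Prod>j\<in>J. (\<Sum>i\<in>X. character {i} D) - m j)
       = (-1) ^ card J * (\<Sum>S\<in>Pow X. (-1) ^ card S * b S * character S D)"
    using insert.IH[OF insert.prems[OF insertI2]] by auto
  define b' where "b' S = m j * b S + (\<Sum>i\<in>X. b (sym_diff S {i}))" for S
  have "b' S \<ge> 0" for S
    unfolding b'_def using b(1) insert.prems by (intro add_nonneg_nonneg sum_nonneg mult_nonneg_nonneg) auto
  moreover have "card S \<le> card (insert j J)" if "finite S" "b' S \<noteq> 0" for S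
  proof (rule ccontr)
    assume "\<not> ?thesis"
    then have S: "card S > Suc (card J)" using insert by simp
    have "b S = 0" using b(2)[of S] S that by auto
    moreover have "b (sym_diff S {i}) = 0" for i
    proof -
      have "card S \<le> Suc (card (sym_diff S {i}))"
        using that by (cases "i \<in> S") (auto simp: card_Diff_singleton)
      then show ?thesis using b(2)[of "sym_diff S {i}"] S that by fastforce
    qed
    ultimately show False using that by (simp add: b'_def)
  qed
  moreover have "(\<Prod>j\<in>insert j J. (\<Sum>i\<in>X. character {i} D) - m j)
       = (-1) ^ card (insert j J) * (\<Sum>S\<in>Pow X. (-1) ^ card S * b' S * character S D)" for D
  proof -
    define f where "f S = (-1) ^ card S * b S * character S D" for S
    \<comment> \<open>Reindexing along the involution that toggles \<open>i\<close>; the minus sign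
      records the change of parity of \<open>card S\<close>.\<close>
    have shift: "character {i} D * (\<Sum>S\<in>Pow X. f S)
      = - (\<Sum>S\<in>Pow X. (-1) ^ card S * b (sym_diff S {i}) * character S D)" if "i \<in> X" for i
    proof -
      have "(\<Sum>S\<in>Pow X. character {i} D * f S)
        = (\<Sum>S\<in>Pow X. character {i} D * f (sym_diff S {i}))"
        by (rule sum.reindex_bij_witness[of _ "\<lambda>S. sym_diff S {i}" "\<lambda>S. sym_diff S {i}"])
          (use that in \<open>auto intro!: arg_cong[where f = f]\<close>)
      also have "\<dots> = (\<Sum>S\<in>Pow X. - ((-1) ^ card S * b (sym_diff S {i}) * character S D))"
      proof (rule sum.cong)
        fix S assume "S \<in> Pow X"
        then have "finite S" using assms(1) finite_subset by blast
        then have "f (sym_diff S {i}) = - ((-1) ^ card S) * b (sym_diff S {i})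
            * (character S D * character {i} D)"
          by (simp only: f_def character_sym_diff_left minus_one_power_card_sym_diff finite.intros) simp
        moreover have "character {i} D * (character {i} D * x) = x" for x
          by (simp add: character_def)
        ultimately show "character {i} D * f (sym_diff S {i})
          = - ((-1) ^ card S * b (sym_diff S {i}) * character S D)"
          by (simp add: mult_ac del: Diff_insert0 Diff_insert)
      qed simp
      finally show ?thesis by (simp add: sum_distrib_left sum_negf)
    qed
    have "((\<Sum>i\<in>X. character {i} D) - m j) * (\<Sum>S\<in>Pow X. f S)
      = - (\<Sum>i\<in>X. \<Sum>S\<in>Pow X. (-1) ^ card S * b (sym_diff S {i}) * character S D)
        - m j * (\<Sum>S\<in>Pow X. f S)"
      by (simp add: left_diff_distrib sum_distrib_right shift sum_negf)
    also have "\<dots> = - (\<Sum>S\<in>Pow X. (-1) ^ card S * b' S * character S D)"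
      by (subst sum.swap)
        (simp add: b'_def f_def sum_distrib_left sum_distrib_right sum.distrib algebra_simps)
    finally show ?thesis
      using insert by (simp add: b(3) f_def mult.left_commute)
  qed
  ultimately show ?case by blast
qed

section \<open>The quadratic form argument\<close>

text \<open>Otherwise some nonzero \<open>g\<close> on \<open>F\<close> is orthogonal to every
  character with a positive coefficient, and the quadratic form with kernel
  \<open>P (sym_diff A B)\<close> would be both positive and nonpositive at \<open>g\<close>. The
  assumption \<open>4 * l j \<le> card X\<close> supplies the nonnegative constants for the
  expansion, and \<open>l j > 0\<close> makes the diagonal value \<open>P {}\<close>
  positive.\<close>

lemma card_le_parity_ball:
  fixes l :: "'b \<Rightarrow> nat" and F :: "'a set set"
  assumes "finite X" "F \<subseteq> Pow X" "finite J"
    and l: "\<And>j. j \<in> J \<Longrightarrow> l j > 0" "\<And>j. j \<in> J \<Longrightarrow> 4 * l j \<le> card X"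
    and dist: "\<And>A B. A \<in> F \<Longrightarrow> B \<in> F \<Longrightarrow> A \<noteq> B \<Longrightarrow> \<exists>j\<in>J. card (sym_diff A B) = 2 * l j"
  shows "card F \<le> card {S. S \<subseteq> X \<and> card S \<le> card J \<and> even (card S + card J)}"
proof (rule ccontr)
  define T where "T = {S. S \<subseteq> X \<and> card S \<le> card J \<and> even (card S + card J)}"
  assume "\<not> ?thesis"
  then have less: "card T < card F" by (simp add: T_def)
  have finF: "finite F" and finT: "finite T"
    using assms(1,2) by (auto simp: T_def intro: finite_subset)
  have finA: "finite A" if "A \<in> F" for A using that assms(1,2) by (auto intro: finite_subset)
  obtain g where g: "\<exists>A\<in>F. g A \<noteq> 0" "\<And>S. S \<in> T \<Longrightarrow> (\<Sum>A\<in>F. g A * character S A) = 0"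
    using nontrivial_solution[OF finT finF less, of character] by blast
  obtain b where b: "\<And>S. b S \<ge> 0" "\<And>S. finite S \<Longrightarrow> b S \<noteq> 0 \<Longrightarrow> card S \<le> card J"
    "\<And>D. (\<Prod>j\<in>J. (\<Sum>i\<in>X. character {i} D) - (real (card X) - 4 * real (l j)))
       = (-1) ^ card J * (\<Sum>S\<in>Pow X. (-1) ^ card S * b S * character S D)"
    using sign_alternating_expansion[OF assms(1,3), of "\<lambda>j. real (card X) - 4 * real (l j)"]
      of_nat_mono[OF l(2), where ?'a = real] by auto
  define P where "P D = (\<Prod>j\<in>J. (\<Sum>i\<in>X. character {i} D) - (real (card X) - 4 * real (l j)))" for D
  have P_expand: "P D = (-1) ^ card J * (\<Sum>S\<in>Pow X. (-1) ^ card S * b S * character S D)" for D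
    unfolding P_def by (rule b(3))
  have P_eq: "P D = (\<Prod>j\<in>J. 4 * real (l j) - 2 * real (card D))" if "D \<subseteq> X" for D
    unfolding P_def using sum_character_singleton[OF assms(1) that] by (intro prod.cong) auto
  have P_empty: "P {} > 0" using l(1) by (simp add: P_eq prod_pos)
  have P_dist: "P (sym_diff A B) = 0" if AB: "A \<in> F" "B \<in> F" "A \<noteq> B" for A B
  proof -
    obtain j where "j \<in> J" "card (sym_diff A B) = 2 * l j" using dist[OF AB] by blast
    then have "\<exists>j\<in>J. 4 * real (l j) - 2 * real (card (sym_diff A B)) = 0" by force
    moreover have "sym_diff A B \<subseteq> X" using AB assms(2) by blast
    ultimately show ?thesis using assms(3) by (simp add: P_eq prod_zero)
  qed
  \<comment> \<open>First evaluation of the form, by entries: the kernel vanishes off the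
    diagonal.\<close>
  have "(\<Sum>A\<in>F. \<Sum>B\<in>F. g A * g B * P (sym_diff A B)) = (\<Sum>A\<in>F. (g A)\<^sup>2 * P {})"
  proof (rule sum.cong)
    fix A assume A: "A \<in> F"
    have "(\<Sum>B\<in>F. g A * g B * P (sym_diff A B)) = (\<Sum>B\<in>F. if B = A then (g A)\<^sup>2 * P {} else 0)"
      by (rule sum.cong) (use P_dist A in \<open>auto simp: power2_eq_square\<close>)
    then show "(\<Sum>B\<in>F. g A * g B * P (sym_diff A B)) = (g A)\<^sup>2 * P {}"
      using A finF by simp
  qed simp
  moreover have "(\<Sum>A\<in>F. (g A)\<^sup>2 * P {}) > 0"
  proof -
    obtain A where "A \<in> F" "g A \<noteq> 0" using g by blast
    then show ?thesis using P_empty finF by (intro sum_pos2[of _ A]) auto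
  qed
  moreover have "(\<Sum>A\<in>F. \<Sum>B\<in>F. g A * g B * P (sym_diff A B)) \<le> 0"
  proof -
    \<comment> \<open>Second evaluation, by characters: multiplicativity on
      \<open>sym_diff A B\<close> separates \<open>A\<close> from \<open>B\<close>, so each
      \<open>S\<close> contributes a multiple of a square.\<close>
    have "(\<Sum>A\<in>F. \<Sum>B\<in>F. g A * g B * P (sym_diff A B))
      = (\<Sum>A\<in>F. \<Sum>B\<in>F. \<Sum>S\<in>Pow X.
          (-1) ^ (card J + card S) * b S * (g A * character S A * (g B * character S B)))"
      by (intro sum.cong refl)
        (simp add: P_expand character_sym_diff_right finA sum_distrib_left power_add mult_ac)
    also have "\<dots> = (\<Sum>A\<in>F. \<Sum>S\<in>Pow X. \<Sum>B\<in>F.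
          (-1) ^ (card J + card S) * b S * (g A * character S A * (g B * character S B)))"
      by (intro sum.cong refl sum.swap)
    also have "\<dots> = (\<Sum>S\<in>Pow X. \<Sum>A\<in>F. \<Sum>B\<in>F.
          (-1) ^ (card J + card S) * b S * (g A * character S A * (g B * character S B)))"
      by (rule sum.swap)
    also have "\<dots> = (\<Sum>S\<in>Pow X. (-1) ^ (card J + card S) * b S * (\<Sum>A\<in>F. g A * character S A)\<^sup>2)"
      by (simp only: power2_eq_square sum_product) (simp only: sum_distrib_left)
    also have "\<dots> \<le> 0"
    proof (rule sum_nonpos)
      fix S assume "S \<in> Pow X"
      then have S: "S \<subseteq> X" "finite S" using assms(1) finite_subset by auto
      \<comment> \<open>Sets larger than \<open>card J\<close> have weight zero. Among the others,
        those with the parity of \<open>card J\<close> lie in \<open>T\<close>, where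
        \<open>g\<close> makes the square vanish, and the rest carry a negative sign.\<close>
      consider "b S = 0" | "S \<in> T" | "odd (card J + card S)"
        using b(2)[OF S(2)] S(1) by (auto simp: T_def)
      then show "(-1) ^ (card J + card S) * b S * (\<Sum>A\<in>F. g A * character S A)\<^sup>2 \<le> 0"
      proof cases
        case 3
        then show ?thesis using b(1)[of S] by simp
      qed (use g(2) in auto)
    qed
    finally show ?thesis .
  qed
  ultimately show False by linarith
qed

section \<open>Counting sets of fixed parity\<close>

lemma card_subsets_card_le:
  assumes "finite X"
  shows "card {S. S \<subseteq> X \<and> card S \<le> t} = (\<Sum>i=0..t. card X choose i)"
proof -
  have "{S. S \<subseteq> X \<and> card S \<le> t} = (\<Union>i\<in>{0..t}. {S. S \<subseteq> X \<and> card S = i})" by auto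
  also have "card \<dots> = (\<Sum>i=0..t. card {S. S \<subseteq> X \<and> card S = i})"
    using assms by (intro card_UN_disjoint) auto
  finally show ?thesis using assms by (simp add: n_subsets)
qed

text \<open>The parity \<open>p\<close> determines whether \<open>x\<close> belongs to
  \<open>S\<close>, so \<open>S\<close> can be recovered from \<open>S - {x}\<close>. The size is
  bounded after deleting \<open>x\<close> so that one count serves both the upper bound and the
  extremal family, whose members may have \<open>t + 1\<close> elements.\<close>

lemma card_parity_ball:
  assumes "finite X" "x \<notin> X"
  shows "card {S. S \<subseteq> insert x X \<and> card (S - {x}) \<le> t \<and> even (card S) = p}
    = (\<Sum>i=0..t. card X choose i)"
proof -
  have fin: "finite S" if "S \<subseteq> insert x X" for S
    using that assms(1) finite_subset by blast
  have eq: "(if even (card (S - {x})) = p then S - {x} else insert x (S - {x})) = S"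
    if "S \<subseteq> insert x X" "even (card S) = p" for S
  proof (cases "x \<in> S")
    case True
    then have "card S = Suc (card (S - {x}))" using fin[OF that(1)] by (simp only: card_Suc_Diff1)
    then show ?thesis using True that by auto
  qed (use that in auto)
  have "bij_betw (\<lambda>S. S - {x})
      {S. S \<subseteq> insert x X \<and> card (S - {x}) \<le> t \<and> even (card S) = p} {S. S \<subseteq> X \<and> card S \<le> t}"
  proof (rule bij_betw_byWitness[where f' = "\<lambda>S. if even (card S) = p then S else insert x S"])
    show "\<forall>S\<in>{S. S \<subseteq> insert x X \<and> card (S - {x}) \<le> t \<and> even (card S) = p}.
      (if even (card (S - {x})) = p then S - {x} else insert x (S - {x})) = S"
      using eq by blast
    show "\<forall>S\<in>{S. S \<subseteq> X \<and> card S \<le> t}. (if even (card S) = p then S else insert x S) - {x} = S"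
      using assms by auto
    show "(\<lambda>S. if even (card S) = p then S else insert x S) ` {S. S \<subseteq> X \<and> card S \<le> t}
      \<subseteq> {S. S \<subseteq> insert x X \<and> card (S - {x}) \<le> t \<and> even (card S) = p}"
    proof clarify
      fix S assume S: "S \<subseteq> X" "card S \<le> t"
      then have "finite S" "x \<notin> S" using assms finite_subset by auto
      then show "(if even (card S) = p then S else insert x S) \<subseteq> insert x X \<and>
        card ((if even (card S) = p then S else insert x S) - {x}) \<le> t \<and>
        even (card (if even (card S) = p then S else insert x S)) = p"
        using S by auto
    qed
  qed auto
  then show ?thesis
    by (simp only: bij_betw_same_card card_subsets_card_le[OF assms(1)])
qed

lemma even_card_sym_diff:
  assumes "finite A" "finite B" "odd (card A)" "odd (card B)"
  shows "even (card (sym_diff A B))"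
proof -
  have "(-1 :: real) ^ card (sym_diff A B) = 1"
    using assms minus_one_power_card_sym_diff[of A B] by simp
  then show ?thesis by (cases "even (card (sym_diff A B))") (auto simp del: card_Un_disjoint)
qed

text \<open>The extra one accounts for \<open>x\<close>, which may lie in exactly one of the two
  sets.\<close>

lemma card_sym_diff_le:
  assumes "finite A" "finite B"
  shows "card (sym_diff A B) \<le> Suc (card (A - {x}) + card (B - {x}))"
proof -
  have "card (sym_diff A B) \<le> card (insert x ((A - {x}) \<union> (B - {x})))"
    using assms by (intro card_mono) auto
  also have "\<dots> \<le> Suc (card ((A - {x}) \<union> (B - {x})))"
    by (simp add: card_insert_le_m1 assms card_insert_if)
  also have "\<dots> \<le> Suc (card (A - {x}) + card (B - {x}))"
    using card_Un_le by simp
  finally show ?thesis .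
qed

section \<open>The bound on the odd subcube and its sharpness\<close>

theorem corollary4p2:
  fixes t :: nat and l :: "nat \<Rightarrow> nat"
  assumes "t \<ge> 1"
    and "inj_on l {1..t}"
    and "\<And>j. j \<in> {1..t} \<Longrightarrow> l j > 0"
  shows "\<exists>n0::nat.
    (\<forall>n\<ge>n0. \<forall>F. F \<subseteq> odd_subcube n \<and> distances_in {2 * l j | j. j \<in> {1..t}} F
        \<longrightarrow> card F \<le> (\<Sum>i=0..t. (n - 1) choose i)) \<and>
    ((\<forall>j\<in>{1..t}. l j = j) \<longrightarrow>
      (\<forall>n\<ge>n0. \<exists>F. F \<subseteq> odd_subcube n \<and> distances_in {2 * l j | j. j \<in> {1..t}} F
        \<and> card F = (\<Sum>i=0..t. (n - 1) choose i)))"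
proof -
  \<comment> \<open>The sum dominates each \<open>4 * l j\<close>, and the successor gives
    \<open>n \<ge> 1\<close>, so that \<open>n\<close> can be split off from
    \<open>{1..n}\<close>.\<close>
  define n0 where "n0 = Suc (\<Sum>j\<in>{1..t}. 4 * l j)"
  have insert_n: "{1..n} = insert n {1..n - 1}" "n \<notin> {1..n - 1}" if "n \<ge> n0" for n
    using that by (auto simp: n0_def)
  have "card F \<le> (\<Sum>i=0..t. (n - 1) choose i)"
    if n: "n \<ge> n0" and F: "F \<subseteq> odd_subcube n" "distances_in {2 * l j | j. j \<in> {1..t}} F" for n F
  proof -
    have "card F \<le> card {S. S \<subseteq> {1..n} \<and> card S \<le> card {1..t} \<and> even (card S + card {1..t})}"
    proof (rule card_le_parity_ball[where l = l])
      show "4 * l j \<le> card {1..n}" if "j \<in> {1..t}" for j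
        using member_le_sum[OF that, of "\<lambda>j. 4 * l j"] n by (simp add: n0_def)
      show "\<exists>j\<in>{1..t}. card (sym_diff A B) = 2 * l j" if "A \<in> F" "B \<in> F" "A \<noteq> B" for A B
        using F(2) that unfolding distances_in_def by blast
    qed (use F assms(3) in \<open>auto simp: odd_subcube_def\<close>)
    also have "{S. S \<subseteq> {1..n} \<and> card S \<le> card {1..t} \<and> even (card S + card {1..t})}
      \<subseteq> {S. S \<subseteq> insert n {1..n - 1} \<and> card (S - {n}) \<le> t \<and> even (card S) = even t}"
      using insert_n[OF n] by (auto intro: order.trans[OF card_Diff1_le])
    then have "card {S. S \<subseteq> {1..n} \<and> card S \<le> card {1..t} \<and> even (card S + card {1..t})}
      \<le> card {S. S \<subseteq> insert n {1..n - 1} \<and> card (S - {n}) \<le> t \<and> even (card S) = even t}"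
      by (intro card_mono) auto
    also have "\<dots> = (\<Sum>i=0..t. (n - 1) choose i)"
      using card_parity_ball[of "{1..n - 1}" n] insert_n[OF n] by simp
    finally show ?thesis .
  qed
  moreover have "\<exists>F. F \<subseteq> odd_subcube n \<and> distances_in {2 * l j | j. j \<in> {1..t}} F
        \<and> card F = (\<Sum>i=0..t. (n - 1) choose i)"
    if l: "\<forall>j\<in>{1..t}. l j = j" and n: "n \<ge> n0" for n
  proof -
    \<comment> \<open>The extremal family: every subset of \<open>{1..n - 1}\<close> with at most
      \<open>t\<close> elements, with \<open>n\<close> adjoined exactly when its size is
      even.\<close>
    define F where "F = {S. S \<subseteq> insert n {1..n - 1} \<and> card (S - {n}) \<le> t \<and> even (card S) = False}"
    have sub: "F \<subseteq> odd_subcube n"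
      using insert_n[OF n] by (auto simp: F_def odd_subcube_def)
    have "card (sym_diff A B) \<in> {2 * l j | j. j \<in> {1..t}}"
      if AB: "A \<in> F" "B \<in> F" "A \<noteq> B" for A B
    proof -
      have fin: "finite A" "finite B"
        using AB by (auto simp: F_def intro: finite_subset[of _ "insert n {1..n - 1}"])
      then have "even (card (sym_diff A B))"
        using AB by (intro even_card_sym_diff) (auto simp: F_def)
      then obtain k where k: "card (sym_diff A B) = 2 * k" by blast
      have "sym_diff A B \<noteq> {}" using AB(3) by blast
      then have "card (sym_diff A B) \<noteq> 0" using fin by simp
      moreover have "card (sym_diff A B) \<le> Suc (t + t)"
        using card_sym_diff_le[OF fin, of n] AB by (simp add: F_def)
      \<comment> \<open>Evenness absorbs the off-by-one: \<open>2 * k \<le> 2 * t + 1\<close> forces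
        \<open>k \<le> t\<close>.\<close>
      ultimately have "k \<in> {1..t}" using k by auto
      then show ?thesis using k l by force
    qed
    moreover have "card F = (\<Sum>i=0..t. (n - 1) choose i)"
      unfolding F_def using card_parity_ball[of "{1..n - 1}" n t False] insert_n[OF n] by simp
    ultimately show ?thesis using sub unfolding distances_in_def by blast
  qed
  ultimately show ?thesis
    by (intro exI[of _ n0] conjI allI impI) simp_all
qed

end
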